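(* Let $\alpha,\beta\in(0,1]$ and $0<\tau<1$. Put $$u(t,s)=\frac{(\alpha+\beta)t^{\alpha}s^{\beta}-\alpha t^{\alpha+\beta}}{\alpha\beta(\alpha+\beta)},\qquad x(t,s)=\frac{\alpha t^{\alpha}(t^{\beta}-s^{\beta})+\beta s^{\beta}(s^{\alpha}-t^{\alpha})}{\alpha\beta(\alpha+\beta)},$$ and for $t,s\in[0,1]$ let $$G(t,s)=\begin{cases} s\in[0,\tau]: & \begin{cases}u(t,s) & : t\le s,\\ x(0,s) & : s\le t,\end{cases}\\[2ex] s\in[\tau,1]: & \begin{cases}u(t,\tau) & : t\le s,\\ u(t,\tau)+x(t,s) & : s\le t.\end{cases}\end{cases}$$ Suppose that $u(1,\tau)>0$, that is to say, $$\tau>\left(\frac{\alpha}{\alpha+\beta}\right)^{1/\beta}.$$ Then $$0<G(t,s)\le G(\tau,s)\qquad\text{for all } t\in(0,1],\ s\in(0,1].$$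
   Context: $G$ is the Green's function of the conformable fractional right-focal problem $D^{\gamma}D^{\beta}D^{\alpha}y=0$, $y(0)=D^{\alpha}y(\tau)=D^{\beta}D^{\alpha}y(1)=0$ (with $\gamma\in(0,1]$), but the claim only uses the explicit formula for $G$, in which overlapping branches agree. *)

theory Defs
  imports Complex_Main
begin

text \<open>
  Real powers are rendered by \<open>powr\<close>. All bases are nonnegative and all exponents positive, so
  the library convention \<open>0 powr a = 0\<close> gives the intended value at \<open>0\<close>.
\<close>

definition green_u :: "real \<Rightarrow> real \<Rightarrow> real \<Rightarrow> real \<Rightarrow> real" where
  "green_u \<alpha> \<beta> t s =
     ((\<alpha> + \<beta>) * t powr \<alpha> * s powr \<beta> - \<alpha> * t powr (\<alpha> + \<beta>)) / (\<alpha> * \<beta> * (\<alpha> + \<beta>))"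

definition green_x :: "real \<Rightarrow> real \<Rightarrow> real \<Rightarrow> real \<Rightarrow> real" where
  "green_x \<alpha> \<beta> t s =
     (\<alpha> * t powr \<alpha> * (t powr \<beta> - s powr \<beta>) + \<beta> * s powr \<beta> * (s powr \<alpha> - t powr \<alpha>))
       / (\<alpha> * \<beta> * (\<alpha> + \<beta>))"

text \<open>
  The four branches overlap for \<open>s = \<tau>\<close> and for \<open>t = s\<close>; the choice made there by the nested
  conditionals is immaterial, see \<open>green_branches\<close>. Only the values for \<open>t, s \<in> [0,1]\<close> are meaningful.
\<close>

definition green :: "real \<Rightarrow> real \<Rightarrow> real \<Rightarrow> real \<Rightarrow> real \<Rightarrow> real" where
  "green \<alpha> \<beta> \<tau> t s =
     (if s \<le> \<tau> then (if t \<le> s then green_u \<alpha> \<beta> t s else green_x \<alpha> \<beta> 0 s)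
      else (if t \<le> s then green_u \<alpha> \<beta> t \<tau> else green_u \<alpha> \<beta> t \<tau> + green_x \<alpha> \<beta> t s))"

lemma green_u_diag:
  assumes "\<alpha> > 0" "\<beta> > 0"
  shows "green_u \<alpha> \<beta> s s = green_x \<alpha> \<beta> 0 s"
  using assms by (simp add: green_u_def green_x_def powr_add algebra_simps)

lemma green_x_diag: "green_x \<alpha> \<beta> s s = 0"
  by (simp add: green_x_def)

lemma green_u_plus_x:
  assumes "\<alpha> > 0" "\<beta> > 0"
  shows "green_u \<alpha> \<beta> t s + green_x \<alpha> \<beta> t s = green_x \<alpha> \<beta> 0 s"
  using assms by (simp add: green_u_def green_x_def powr_add algebra_simps flip: add_divide_distrib)

lemma green_branches:
  assumes "\<alpha> > 0" "\<beta> > 0"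
  shows "s \<le> \<tau> \<Longrightarrow> t \<le> s \<Longrightarrow> green \<alpha> \<beta> \<tau> t s = green_u \<alpha> \<beta> t s"
    and "s \<le> \<tau> \<Longrightarrow> s \<le> t \<Longrightarrow> green \<alpha> \<beta> \<tau> t s = green_x \<alpha> \<beta> 0 s"
    and "\<tau> \<le> s \<Longrightarrow> t \<le> s \<Longrightarrow> green \<alpha> \<beta> \<tau> t s = green_u \<alpha> \<beta> t \<tau>"
    and "\<tau> \<le> s \<Longrightarrow> s \<le> t \<Longrightarrow> green \<alpha> \<beta> \<tau> t s = green_u \<alpha> \<beta> t \<tau> + green_x \<alpha> \<beta> t s"
  using green_u_diag[OF assms] green_u_plus_x[OF assms] green_x_diag
  by (auto simp: green_def)

end

theory Submission
  imports Defs "HOL-Analysis.Convex"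
begin

text \<open>
  Everything rests on the fact that \<open>t \<mapsto> u(t,s)\<close> attains its maximum over the positive reals at
  \<open>t = s\<close>. Up to the positive denominator this says
  \<open>(\<alpha> + \<beta>) t\<^sup>\<alpha> s\<^sup>\<beta> \<le> \<alpha> t\<^sup>\<alpha>\<^sup>+\<^sup>\<beta> + \<beta> s\<^sup>\<alpha>\<^sup>+\<^sup>\<beta>\<close>, which is Young's inequality for the numbers
  \<open>t\<^sup>\<alpha>\<^sup>+\<^sup>\<beta>\<close>, \<open>s\<^sup>\<alpha>\<^sup>+\<^sup>\<beta>\<close> with the weights \<open>\<alpha>/(\<alpha>+\<beta>)\<close>, \<open>\<beta>/(\<alpha>+\<beta>)\<close> (\<open>green_u_le_diag\<close>). Since
  \<open>x(t,s) = u(s,s) - u(t,s)\<close>, it also says that \<open>x\<close> is nonnegative.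

  For \<open>s \<le> \<tau>\<close> the function \<open>G(\<cdot>,s)\<close> follows \<open>u(\<cdot>,s)\<close> up to its maximum and then stays at the
  maximal value. For \<open>s > \<tau>\<close> it follows \<open>u(\<cdot>,\<tau>)\<close>, whose maximum is at \<open>\<tau>\<close>, up to \<open>t = s\<close>. Beyond
  \<open>s\<close> the powers \<open>t\<^sup>\<alpha>\<^sup>+\<^sup>\<beta>\<close> in \<open>u(t,\<tau>)\<close> and \<open>x(t,s)\<close> cancel, so that the sum is a constant minus a
  positive multiple of \<open>t\<^sup>\<alpha>\<close> and cannot exceed its value \<open>u(s,\<tau>)\<close> at \<open>t = s\<close>
  (\<open>green_u_add_x_le\<close>).

  Positivity comes from the factorization
  \<open>u(t,s) = t\<^sup>\<alpha> ((\<alpha>+\<beta>) s\<^sup>\<beta> - \<alpha> t\<^sup>\<beta>) / (\<alpha>\<beta>(\<alpha>+\<beta>))\<close>: the bracket decreases in \<open>t\<close>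
  and is positive at \<open>t = s\<close>, which settles the case \<open>s \<le> \<tau>\<close>. For \<open>s > \<tau>\<close> the arguments of \<open>u(t,\<tau>)\<close>
  may lie beyond \<open>\<tau>\<close>, and here the hypothesis \<open>u(1,\<tau>) > 0\<close> gives \<open>u(t,\<tau>) > 0\<close> on all of \<open>(0,1]\<close>;
  adding the nonnegative \<open>x(t,s)\<close> keeps it positive.
\<close>

lemma green_u_pos_iff:
  assumes "\<alpha> > 0" "\<beta> > 0" "t > 0"
  shows "green_u \<alpha> \<beta> t s > 0 \<longleftrightarrow> \<alpha> * t powr \<beta> < (\<alpha> + \<beta>) * s powr \<beta>"
proof -
  have "green_u \<alpha> \<beta> t s =
      t powr \<alpha> / (\<alpha> * \<beta> * (\<alpha> + \<beta>)) * ((\<alpha> + \<beta>) * s powr \<beta> - \<alpha> * t powr \<beta>)"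
    by (simp add: green_u_def powr_add algebra_simps diff_divide_distrib)
  moreover have "t powr \<alpha> / (\<alpha> * \<beta> * (\<alpha> + \<beta>)) > 0"
    using assms by simp
  ultimately show ?thesis
    by (metis diff_gt_0_iff_gt mult_pos_pos zero_less_mult_pos)
qed

lemma green_u_one_pos_iff:
  assumes "\<alpha> > 0" "\<beta> > 0" "\<tau> > 0"
  shows "green_u \<alpha> \<beta> 1 \<tau> > 0 \<longleftrightarrow> \<tau> > (\<alpha> / (\<alpha> + \<beta>)) powr (1 / \<beta>)"
proof -
  define r where "r = \<alpha> / (\<alpha> + \<beta>)"
  have "r > 0"
    using assms by (simp add: r_def)
  have "green_u \<alpha> \<beta> 1 \<tau> > 0 \<longleftrightarrow> r < \<tau> powr \<beta>"
    using green_u_pos_iff[of \<alpha> \<beta> 1 \<tau>] assms by (simp add: r_def field_simps)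
  also have "r = (r powr (1 / \<beta>)) powr \<beta>"
    using assms \<open>r > 0\<close> by (simp add: powr_powr)
  also have "\<dots> < \<tau> powr \<beta> \<longleftrightarrow> r powr (1 / \<beta>) < \<tau>"
    using powr_less_mono2[of \<beta> "r powr (1 / \<beta>)" \<tau>] powr_mono2[of \<beta> \<tau> "r powr (1 / \<beta>)"] assms
    by force
  finally show ?thesis
    by (simp add: r_def)
qed

lemma green_u_pos_below_one:
  assumes "\<alpha> > 0" "\<beta> > 0" "0 < t" "t \<le> 1" "green_u \<alpha> \<beta> 1 s > 0"
  shows "green_u \<alpha> \<beta> t s > 0"
proof -
  have "\<alpha> * t powr \<beta> \<le> \<alpha> * 1"
    using assms by (intro mult_left_mono) (auto simp: powr_le1)
  also have "\<dots> < (\<alpha> + \<beta>) * s powr \<beta>"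
    using assms green_u_pos_iff[of \<alpha> \<beta> 1 s] by simp
  finally show ?thesis
    using assms green_u_pos_iff by blast
qed

lemma green_u_pos_below_diag:
  assumes "\<alpha> > 0" "\<beta> > 0" "0 < t" "t \<le> s"
  shows "green_u \<alpha> \<beta> t s > 0"
proof -
  have "\<alpha> * t powr \<beta> \<le> \<alpha> * s powr \<beta>"
    using assms by (intro mult_left_mono powr_mono2) auto
  also have "\<dots> < (\<alpha> + \<beta>) * s powr \<beta>"
    using assms by (intro mult_strict_right_mono) auto
  finally show ?thesis
    using assms green_u_pos_iff by blast
qed

text \<open>
  The sign of the derivative of \<open>u(\<cdot>,s)\<close> is that of \<open>s\<^sup>\<beta> - t\<^sup>\<beta>\<close>, so \<open>t = s\<close> is the only candidate for
  the maximum; Young's inequality, with equality at \<open>t = s\<close>, gives the bound without calculus.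
\<close>
lemma green_u_le_diag:
  assumes "\<alpha> > 0" "\<beta> > 0" "t > 0" "s > 0"
  shows "green_u \<alpha> \<beta> t s \<le> green_u \<alpha> \<beta> s s"
proof -
  define c where "c = \<alpha> + \<beta>"
  have c: "c > 0"
    using assms by (simp add: c_def)
  have "(t powr c) powr (\<alpha> / c) * (s powr c) powr (\<beta> / c) \<le> \<alpha> / c * t powr c + \<beta> / c * s powr c"
    using assms c by (intro Youngs_inequality_0) (auto simp: c_def simp flip: add_divide_distrib)
  then have "t powr \<alpha> * s powr \<beta> \<le> \<alpha> / c * t powr c + \<beta> / c * s powr c"
    using c by (simp add: powr_powr)
  then have "c * (t powr \<alpha> * s powr \<beta>) \<le> c * (\<alpha> / c * t powr c + \<beta> / c * s powr c)"
    using c by (intro mult_left_mono) auto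
  then have young: "c * (t powr \<alpha> * s powr \<beta>) \<le> \<alpha> * t powr c + \<beta> * s powr c"
    using c by (simp add: distrib_left)
  then have "c * t powr \<alpha> * s powr \<beta> - \<alpha> * t powr c \<le> c * s powr \<alpha> * s powr \<beta> - \<alpha> * s powr c"
    by (simp add: c_def powr_add algebra_simps)
  then show ?thesis
    unfolding green_u_def using assms by (intro divide_right_mono) (auto simp: c_def)
qed

lemma green_x_nonneg:
  assumes "\<alpha> > 0" "\<beta> > 0" "t > 0" "s > 0"
  shows "green_x \<alpha> \<beta> t s \<ge> 0"
  using green_u_le_diag[OF assms] green_u_plus_x[of \<alpha> \<beta> t s] green_u_diag[of \<alpha> \<beta> s] assms by simp

text \<open>
  In the difference of the two sides only \<open>(t\<^sup>\<alpha> - s\<^sup>\<alpha>)(s\<^sup>\<beta> - \<sigma>\<^sup>\<beta>)\<close> survives, up to a positive factor.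
\<close>
lemma green_u_add_x_le:
  assumes "\<alpha> > 0" "\<beta> > 0" "0 \<le> \<sigma>" "\<sigma> \<le> s" "s \<le> t"
  shows "green_u \<alpha> \<beta> t \<sigma> + green_x \<alpha> \<beta> t s \<le> green_u \<alpha> \<beta> s \<sigma>"
proof -
  have "green_u \<alpha> \<beta> s \<sigma> - (green_u \<alpha> \<beta> t \<sigma> + green_x \<alpha> \<beta> t s) =
      (\<alpha> + \<beta>) * (t powr \<alpha> - s powr \<alpha>) * (s powr \<beta> - \<sigma> powr \<beta>) / (\<alpha> * \<beta> * (\<alpha> + \<beta>))"
    unfolding green_u_def green_x_def powr_add
    by (simp add: algebra_simps flip: add_divide_distrib diff_divide_distrib)
  moreover have "s powr \<alpha> \<le> t powr \<alpha>" "\<sigma> powr \<beta> \<le> s powr \<beta>"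
    using assms by (auto intro: powr_mono2)
  ultimately show ?thesis
    using assms by (smt (verit) divide_nonneg_nonneg mult_nonneg_nonneg)
qed

lemma green_pos:
  assumes "\<alpha> > 0" "\<beta> > 0" "0 < t" "t \<le> 1" "0 < s" "green_u \<alpha> \<beta> 1 \<tau> > 0"
  shows "green \<alpha> \<beta> \<tau> t s > 0"
  using green_u_pos_below_one[of \<alpha> \<beta> t \<tau>] green_x_nonneg[of \<alpha> \<beta> t s]
    green_u_pos_below_diag[of \<alpha> \<beta> t s] green_u_pos_below_diag[of \<alpha> \<beta> s s] green_u_diag[of \<alpha> \<beta> s] assms
  by (auto simp: green_def intro: add_pos_nonneg)

lemma green_le_at_focal_point:
  assumes "\<alpha> > 0" "\<beta> > 0" "\<tau> > 0" "t > 0" "s > 0"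
  shows "green \<alpha> \<beta> \<tau> t s \<le> green \<alpha> \<beta> \<tau> \<tau> s"
proof (cases "s \<le> \<tau>")
  case True
  have "green \<alpha> \<beta> \<tau> \<tau> s = green_u \<alpha> \<beta> s s"
    using green_branches(2)[of \<alpha> \<beta> s \<tau> \<tau>] green_u_diag[of \<alpha> \<beta> s] assms True by simp
  with True show ?thesis
    using green_u_le_diag[of \<alpha> \<beta> t s] green_u_diag[of \<alpha> \<beta> s] assms by (simp add: green_def)
next
  case False
  have "green_u \<alpha> \<beta> t \<tau> + green_x \<alpha> \<beta> t s \<le> green_u \<alpha> \<beta> \<tau> \<tau>" if "s < t"
    using green_u_add_x_le[of \<alpha> \<beta> \<tau> s t] green_u_le_diag[of \<alpha> \<beta> s \<tau>] assms that False by linarith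
  with False show ?thesis
    using green_u_le_diag[of \<alpha> \<beta> t \<tau>] assms by (simp add: green_def)
qed

theorem theorem3p2:
  fixes \<alpha> \<beta> \<tau> :: real
  assumes "0 < \<alpha>" and "\<alpha> \<le> 1"
    and "0 < \<beta>" and "\<beta> \<le> 1"
    and "0 < \<tau>" and "\<tau> < 1"
  shows "(green_u \<alpha> \<beta> 1 \<tau> > 0 \<longleftrightarrow> \<tau> > (\<alpha> / (\<alpha> + \<beta>)) powr (1 / \<beta>)) \<and>
    (green_u \<alpha> \<beta> 1 \<tau> > 0 \<longrightarrow>
      (\<forall>t\<in>{0<..1}. \<forall>s\<in>{0<..1}. 0 < green \<alpha> \<beta> \<tau> t s \<and> green \<alpha> \<beta> \<tau> t s \<le> green \<alpha> \<beta> \<tau> \<tau> s))"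
  using green_u_one_pos_iff[of \<alpha> \<beta> \<tau>] green_pos[of \<alpha> \<beta>] green_le_at_focal_point[of \<alpha> \<beta> \<tau>] assms
  by simp

end
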